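(* The representation $\phi_4:T_4\to\operatorname{Aut}(PT_4)\cong\operatorname{Aut}(F_7)$, given by the conjugation action of $T_4$ on its normal subgroup $PT_4\cong F_7$ (the free group of rank 7), is faithful.
   Context: The twin group $T_4$ is the group generated by $s_1,s_2,s_3$ with defining relations $s_1^2=s_2^2=s_3^2=1$ and $s_1s_3=s_3s_1$. The pure twin group $PT_4$ is the kernel of the homomorphism $T_4\to S_4$ mapping $s_i$ to the transposition $(i,i+1)$; it is a free group of rank 7. The homomorphism $\phi_4$ sends an element $g\in T_4$ to the restriction to $PT_4$ of the inner automorphism of $T_4$ given by conjugation by $g$. Faithful means injective. *)

theory Defs
  imports "HOL-Algebra.Bij" "HOL-Algebra.Sym_Groups"
begin

section \<open>Groups given by generators and relations\<close>

text \<open>A letter \<open>(x, True)\<close> stands for the generator \<open>x\<close> and \<open>(x, False)\<close> for its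
  formal inverse. A relation is a pair \<open>(l, r)\<close> of words, read as the equation \<open>l = r\<close>.\<close>

type_synonym 'a gword = "('a \<times> bool) list"

definition gwords :: "'a set \<Rightarrow> 'a gword set" where
  "gwords S = lists (S \<times> UNIV)"

inductive word_eq :: "'a set \<Rightarrow> ('a gword \<times> 'a gword) set \<Rightarrow> 'a gword \<Rightarrow> 'a gword \<Rightarrow> bool"
  for S :: "'a set" and R :: "('a gword \<times> 'a gword) set" where
  refl: "w \<in> gwords S \<Longrightarrow> word_eq S R w w"
| sym: "word_eq S R v w \<Longrightarrow> word_eq S R w v"
| trans: "word_eq S R u v \<Longrightarrow> word_eq S R v w \<Longrightarrow> word_eq S R u w"
| cancel: "u \<in> gwords S \<Longrightarrow> v \<in> gwords S \<Longrightarrow> x \<in> S \<Longrightarrow>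
    word_eq S R (u @ [(x, b), (x, \<not> b)] @ v) (u @ v)"
| rel: "u \<in> gwords S \<Longrightarrow> v \<in> gwords S \<Longrightarrow> (l, r) \<in> R \<Longrightarrow> l \<in> gwords S \<Longrightarrow> r \<in> gwords S \<Longrightarrow>
    word_eq S R (u @ l @ v) (u @ r @ v)"

definition word_class ::
    "'a set \<Rightarrow> ('a gword \<times> 'a gword) set \<Rightarrow> 'a gword \<Rightarrow> 'a gword set" where
  "word_class S R w = {v. word_eq S R w v}"

definition presented_group ::
    "'a set \<Rightarrow> ('a gword \<times> 'a gword) set \<Rightarrow> 'a gword set monoid" where
  "presented_group S R =
    \<lparr>carrier = word_class S R ` gwords S,
     monoid.mult = \<lambda>A B. \<Union>a\<in>A. \<Union>b\<in>B. word_class S R (a @ b),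
     one = word_class S R []\<rparr>"

definition free_group :: "'a set \<Rightarrow> 'a gword set monoid" where
  "free_group S = presented_group S {}"

lemma gwords_simps [simp]:
  "[] \<in> gwords S"
  "p # w \<in> gwords S \<longleftrightarrow> fst p \<in> S \<and> w \<in> gwords S"
  "v @ w \<in> gwords S \<longleftrightarrow> v \<in> gwords S \<and> w \<in> gwords S"
  by (auto simp: gwords_def mem_Times_iff)

lemma word_eq_gwords: "word_eq S R v w \<Longrightarrow> v \<in> gwords S \<and> w \<in> gwords S"
  by (induction rule: word_eq.induct) auto

lemma word_eq_context:
  assumes "word_eq S R v w" "x \<in> gwords S" "y \<in> gwords S"
  shows "word_eq S R (x @ v @ y) (x @ w @ y)"
  using assms
proof (induction rule: word_eq.induct)
  case (cancel u v a b)
  then show ?case using word_eq.cancel[of "x @ u" S "v @ y" a R b] by simp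
next
  case (rel u v l r)
  then show ?case using word_eq.rel[of "x @ u" S "v @ y" l r R] by simp
qed (auto intro: word_eq.intros)

lemma word_eq_append:
  assumes "word_eq S R v v'" "word_eq S R w w'"
  shows "word_eq S R (v @ w) (v' @ w')"
  using word_eq_context[OF assms(1), of "[]" w] word_eq_context[OF assms(2), of v' "[]"]
    word_eq_gwords[OF assms(1)] word_eq_gwords[OF assms(2)]
  by (auto intro: word_eq.trans)

lemma word_class_eq_iff:
  "v \<in> gwords S \<Longrightarrow> word_class S R v = word_class S R w \<longleftrightarrow> word_eq S R v w"
  unfolding word_class_def by (blast intro: word_eq.intros)

lemma presented_group_mult:
  assumes "v \<in> gwords S" "w \<in> gwords S"
  shows "word_class S R v \<otimes>\<^bsub>presented_group S R\<^esub> word_class S R w = word_class S R (v @ w)"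
proof -
  have eq: "word_class S R (a @ b) = word_class S R (v @ w)"
    if "a \<in> word_class S R v" "b \<in> word_class S R w" for a b
  proof -
    have "word_eq S R (v @ w) (a @ b)"
      using that by (intro word_eq_append) (auto simp: word_class_def)
    then show ?thesis using assms by (simp add: word_class_eq_iff[symmetric])
  qed
  have "v \<in> word_class S R v" "w \<in> word_class S R w"
    using assms by (auto simp: word_class_def intro: word_eq.refl)
  then have "(\<Union>a\<in>word_class S R v. \<Union>b\<in>word_class S R w. word_class S R (a @ b)) =
      word_class S R (v @ w)"
    using eq by blast
  then show ?thesis by (simp add: presented_group_def)
qed

definition inv_gword :: "'a gword \<Rightarrow> 'a gword" where
  "inv_gword w = rev (map (\<lambda>(x, b). (x, \<not> b)) w)"

lemma inv_gword_gwords [simp]: "inv_gword w \<in> gwords S \<longleftrightarrow> w \<in> gwords S"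
  by (induction w) (auto simp: inv_gword_def)

lemma word_eq_left_inverse: "w \<in> gwords S \<Longrightarrow> word_eq S R (inv_gword w @ w) []"
proof (induction w)
  case Nil
  then show ?case by (auto simp: inv_gword_def intro: word_eq.refl)
next
  case (Cons p w)
  obtain x b where p: "p = (x, b)" by fastforce
  have "word_eq S R (inv_gword w @ [(x, \<not> b), (x, \<not> \<not> b)] @ w) (inv_gword w @ w)"
    using Cons.prems p by (intro word_eq.cancel) auto
  then show ?case using Cons p by (auto simp: inv_gword_def intro: word_eq.trans)
qed

theorem group_presented_group: "group (presented_group S R)"
proof (rule groupI)
  fix x assume "x \<in> carrier (presented_group S R)"
  then obtain w where w: "w \<in> gwords S" "x = word_class S R w"
    by (auto simp: presented_group_def)
  have one: "\<one>\<^bsub>presented_group S R\<^esub> = word_class S R []" by (simp add: presented_group_def)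
  show "\<one>\<^bsub>presented_group S R\<^esub> \<otimes>\<^bsub>presented_group S R\<^esub> x = x"
    using w by (simp add: one presented_group_mult)
  show "\<exists>y\<in>carrier (presented_group S R). y \<otimes>\<^bsub>presented_group S R\<^esub> x = \<one>\<^bsub>presented_group S R\<^esub>"
  proof (rule bexI[of _ "word_class S R (inv_gword w)"])
    show "word_class S R (inv_gword w) \<otimes>\<^bsub>presented_group S R\<^esub> x = \<one>\<^bsub>presented_group S R\<^esub>"
      using w word_eq_left_inverse[of w S R]
      by (simp add: one presented_group_mult word_class_eq_iff)
  qed (use w in \<open>auto simp: presented_group_def\<close>)
next
  fix x y assume "x \<in> carrier (presented_group S R)" "y \<in> carrier (presented_group S R)"
  then obtain v w where "v \<in> gwords S" "x = word_class S R v" "w \<in> gwords S" "y = word_class S R w"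
    by (auto simp: presented_group_def)
  then show "x \<otimes>\<^bsub>presented_group S R\<^esub> y \<in> carrier (presented_group S R)"
    by (simp add: presented_group_mult) (simp add: presented_group_def)
next
  fix x y z assume "x \<in> carrier (presented_group S R)" "y \<in> carrier (presented_group S R)"
    "z \<in> carrier (presented_group S R)"
  then obtain u v w where "u \<in> gwords S" "x = word_class S R u" "v \<in> gwords S" "y = word_class S R v"
    "w \<in> gwords S" "z = word_class S R w"
    by (auto simp: presented_group_def)
  then show "x \<otimes>\<^bsub>presented_group S R\<^esub> y \<otimes>\<^bsub>presented_group S R\<^esub> z =
      x \<otimes>\<^bsub>presented_group S R\<^esub> (y \<otimes>\<^bsub>presented_group S R\<^esub> z)"
    by (simp add: presented_group_mult)
qed (simp add: presented_group_def)


section \<open>Homomorphisms defined on generators\<close>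

fun word_eval :: "('b, 'c) monoid_scheme \<Rightarrow> ('a \<Rightarrow> 'b) \<Rightarrow> 'a gword \<Rightarrow> 'b" where
  "word_eval G f [] = \<one>\<^bsub>G\<^esub>"
| "word_eval G f ((x, b) # w) = (if b then f x else inv\<^bsub>G\<^esub> f x) \<otimes>\<^bsub>G\<^esub> word_eval G f w"

text \<open>The homomorphism into \<open>G\<close> that extends \<open>f\<close>. It is meaningful only if \<open>f\<close> respects the
  relations, so that evaluation is constant on each class.\<close>

definition pres_lift :: "('b, 'c) monoid_scheme \<Rightarrow> ('a \<Rightarrow> 'b) \<Rightarrow> 'a gword set \<Rightarrow> 'b" where
  "pres_lift G f A = the_elem (word_eval G f ` A)"

context group
begin

lemma word_eval_closed:
  assumes "f \<in> S \<rightarrow> carrier G" "w \<in> gwords S"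
  shows "word_eval G f w \<in> carrier G"
  using assms(2)
proof (induction w)
  case (Cons p w)
  obtain x b where p: "p = (x, b)" by fastforce
  have "f x \<in> carrier G" using assms(1) Cons.prems p by auto
  then show ?case using Cons p by simp
qed simp

lemma word_eval_append:
  assumes "f \<in> S \<rightarrow> carrier G" "v \<in> gwords S" "w \<in> gwords S"
  shows "word_eval G f (v @ w) = word_eval G f v \<otimes> word_eval G f w"
  using assms(2)
proof (induction v)
  case Nil
  then show ?case using assms by (simp add: word_eval_closed)
next
  case (Cons p v)
  obtain x b where p: "p = (x, b)" by fastforce
  have "f x \<in> carrier G" using assms(1) Cons.prems p by auto
  then show ?case
    using Cons p word_eval_closed[OF assms(1)] assms(3) by (simp add: m_assoc)
qed

lemma word_eval_cong:
  assumes f: "f \<in> S \<rightarrow> carrier G"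
    and R: "\<And>l r. (l, r) \<in> R \<Longrightarrow> word_eval G f l = word_eval G f r"
  shows "word_eq S R v w \<Longrightarrow> word_eval G f v = word_eval G f w"
proof (induction rule: word_eq.induct)
  case (cancel u v x b)
  then have "f x \<in> carrier G" "word_eval G f v \<in> carrier G"
    using f word_eval_closed by auto
  then have "word_eval G f ([(x, b), (x, \<not> b)] @ v) = word_eval G f v"
    by (simp add: m_assoc[symmetric])
  then show ?case
    using cancel word_eval_append[OF f, of u "[(x, b), (x, \<not> b)] @ v"] word_eval_append[OF f, of u v]
    by simp
next
  case (rel u v l r)
  then show ?case by (simp add: word_eval_append[OF f] R)
qed auto

lemma pres_lift_word_class:
  assumes f: "f \<in> S \<rightarrow> carrier G"
    and R: "\<And>l r. (l, r) \<in> R \<Longrightarrow> word_eval G f l = word_eval G f r"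
    and w: "w \<in> gwords S"
  shows "pres_lift G f (word_class S R w) = word_eval G f w"
proof -
  have "word_eval G f ` word_class S R w = {word_eval G f w}"
    using word_eval_cong[OF f R] w by (force simp: word_class_def intro: word_eq.refl)
  then show ?thesis by (simp add: pres_lift_def)
qed

lemma pres_lift_hom:
  assumes f: "f \<in> S \<rightarrow> carrier G"
    and R: "\<And>l r. (l, r) \<in> R \<Longrightarrow> word_eval G f l = word_eval G f r"
  shows "pres_lift G f \<in> hom (presented_group S R) G"
proof (rule homI)
  fix x assume "x \<in> carrier (presented_group S R)"
  then show "pres_lift G f x \<in> carrier G"
    by (auto simp: presented_group_def pres_lift_word_class[OF f R] word_eval_closed[OF f])
next
  fix x y assume "x \<in> carrier (presented_group S R)" "y \<in> carrier (presented_group S R)"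
  then obtain v w where "v \<in> gwords S" "x = word_class S R v" "w \<in> gwords S" "y = word_class S R w"
    by (auto simp: presented_group_def)
  then show "pres_lift G f (x \<otimes>\<^bsub>presented_group S R\<^esub> y) = pres_lift G f x \<otimes> pres_lift G f y"
    by (simp add: presented_group_mult pres_lift_word_class[OF f R] word_eval_append[OF f])
qed

end


section \<open>The twin group on four strands\<close>

definition T4_gens :: "nat set" where
  "T4_gens = {1, 2, 3}"

definition T4_rels :: "(nat gword \<times> nat gword) set" where
  "T4_rels =
    {([(1, True), (1, True)], []),
     ([(2, True), (2, True)], []),
     ([(3, True), (3, True)], []),
     ([(1, True), (3, True)], [(3, True), (1, True)])}"

definition T4 :: "nat gword set monoid" where
  "T4 = presented_group T4_gens T4_rels"

definition T4_gen :: "nat \<Rightarrow> nat gword set" where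
  "T4_gen i = word_class T4_gens T4_rels [(i, True)]"

definition T4_to_S4 :: "nat gword set \<Rightarrow> nat \<Rightarrow> nat" where
  "T4_to_S4 = pres_lift (sym_group 4) (\<lambda>i. transpose i (i + 1))"

definition PT4 :: "nat gword set monoid" where
  "PT4 = T4\<lparr>carrier := kernel T4 (sym_group 4) T4_to_S4\<rparr>"

text \<open>The elements of \<open>AutoGroup\<close> are extensional functions, hence the restriction.\<close>

definition phi4 :: "nat gword set \<Rightarrow> nat gword set \<Rightarrow> nat gword set" where
  "phi4 g = (\<lambda>h \<in> carrier PT4. g \<otimes>\<^bsub>T4\<^esub> h \<otimes>\<^bsub>T4\<^esub> inv\<^bsub>T4\<^esub> g)"

lemma group_T4: "group T4"
  by (simp add: T4_def group_presented_group)

lemma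
  shows T4_to_S4_hom: "T4_to_S4 \<in> hom T4 (sym_group 4)"
    and T4_to_S4_gen: "i \<in> T4_gens \<Longrightarrow> T4_to_S4 (T4_gen i) = transpose i (i + 1)"
proof -
  interpret S: group "sym_group 4" by (rule sym_group_is_group)
  let ?f = "\<lambda>i::nat. transpose i (i + 1)"
  have f: "?f \<in> T4_gens \<rightarrow> carrier (sym_group 4)"
    by (auto simp: T4_gens_def sym_group_carrier intro!: permutes_swap_id)
  have R: "word_eval (sym_group 4) ?f l = word_eval (sym_group 4) ?f r"
    if "(l, r) \<in> T4_rels" for l r
    using that by (auto simp: T4_rels_def sym_group_mult sym_group_one fun_eq_iff transpose_def)
  show "T4_to_S4 \<in> hom T4 (sym_group 4)"
    unfolding T4_to_S4_def T4_def by (rule S.pres_lift_hom[OF f R])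
  show "T4_to_S4 (T4_gen i) = transpose i (i + 1)" if "i \<in> T4_gens"
    using that S.pres_lift_word_class[OF f R, where w = "[(i, True)]"]
    by (simp add: T4_to_S4_def T4_gen_def sym_group_mult sym_group_one)
qed

end

theory Submission
  imports Defs
begin

text \<open>The kernel of \<open>T\<^sub>4 \<rightarrow> S\<^sub>4\<close> acts freely on the Bass--Serre tree of
  \<open>T\<^sub>4 = \<langle>s\<^sub>1, s\<^sub>3\<rangle> * \<langle>s\<^sub>2\<rangle>\<close>. The quotient graph is the octahedron: its 6 vertices are the cosets
  of \<open>\<langle>s\<^sub>1, s\<^sub>3\<rangle>\<close> in \<open>S\<^sub>4\<close>, its 12 edges come from \<open>s\<^sub>2\<close>, and the 7 edges outside a spanning tree give
  the free generators. The Reidemeister--Schreier cocycle is realised as a right action of \<open>T\<^sub>4\<close>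
  on \<open>S\<^sub>4 \<times> F\<^sub>7\<close>: \<open>s\<^sub>1\<close> and \<open>s\<^sub>3\<close> only move the permutation, while \<open>s\<^sub>2\<close> also multiplies by the
  value of the edge it crosses. The \<open>F\<^sub>7\<close> component recovers a free group element from its image in \<open>T\<^sub>4\<close>.

  An element in the kernel of the conjugation action centralises the pure twin group. Normal
  forms in the free product show that only the identity commutes with two suitably chosen pure
  words, one that starts and ends with \<open>s\<^sub>2\<close> and one that neither starts nor ends with \<open>s\<^sub>2\<close>.\<close>

section \<open>Automorphism groups and conjugation\<close>

lemma conj_auto:
  assumes "group H" "group_isomorphisms G H h k" and \<alpha>: "\<alpha> \<in> auto G"
  shows "(\<lambda>y\<in>carrier H. h (\<alpha> (k y))) \<in> auto H"
proof -
  have h: "h \<in> hom G H" and k: "k \<in> hom H G"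
    and kh: "\<And>x. x \<in> carrier G \<Longrightarrow> k (h x) = x" and hk: "\<And>y. y \<in> carrier H \<Longrightarrow> h (k y) = y"
    using assms(2) by (auto simp: group_isomorphisms_def)
  have \<alpha>h: "\<alpha> \<in> hom G G" and \<alpha>b: "bij_betw \<alpha> (carrier G) (carrier G)"
    using \<alpha> by (auto simp: auto_def Bij_def)
  have hb: "bij_betw h (carrier G) (carrier H)" and kb: "bij_betw k (carrier H) (carrier G)"
    using h k kh hk bij_betw_byWitness[of "carrier G" k h "carrier H"]
      bij_betw_byWitness[of "carrier H" h k "carrier G"]
    by (auto simp: hom_def Pi_iff image_subset_iff)
  have "bij_betw (h \<circ> (\<alpha> \<circ> k)) (carrier H) (carrier H)"
    by (rule bij_betw_trans[OF bij_betw_trans[OF kb \<alpha>b] hb])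
  then have "bij_betw (\<lambda>y\<in>carrier H. h (\<alpha> (k y))) (carrier H) (carrier H)"
    by (simp cong: bij_betw_cong)
  moreover have "(\<lambda>y\<in>carrier H. h (\<alpha> (k y))) \<in> hom H H"
    using bij_betwE[OF hb] bij_betwE[OF kb] bij_betwE[OF \<alpha>b] h k \<alpha>h
      monoid.m_closed[OF group.is_monoid[OF \<open>group H\<close>]]
    by (intro homI) (auto simp: hom_mult)
  ultimately show ?thesis
    by (simp add: auto_def Bij_def)
qed

text \<open>Transport along the isomorphism \<open>h\<close> with inverse \<open>k\<close> is undone
  by transport along \<open>k\<close>. The two composites are identities as functions because
  automorphisms are extensional.\<close>

lemma AutoGroup_cong:
  assumes "group G" "group H" "G \<cong> H"
  shows "AutoGroup G \<cong> AutoGroup H"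
proof -
  obtain h where "h \<in> iso G H" using assms(3) by (auto simp: is_iso_def)
  then obtain k where iso: "group_isomorphisms G H h k"
    using assms(1,2) group.iso_iff_group_isomorphisms by metis
  then have iso': "group_isomorphisms H G k h"
    by (simp add: group_isomorphisms_def)
  have h: "\<And>x. x \<in> carrier G \<Longrightarrow> h x \<in> carrier H" and k: "\<And>y. y \<in> carrier H \<Longrightarrow> k y \<in> carrier G"
    and kh: "\<And>x. x \<in> carrier G \<Longrightarrow> k (h x) = x" and hk: "\<And>y. y \<in> carrier H \<Longrightarrow> h (k y) = y"
    using iso by (auto simp: group_isomorphisms_def hom_def Pi_iff)
  have mem: "\<alpha> \<in> extensional (carrier K)" "x \<in> carrier K \<Longrightarrow> \<alpha> x \<in> carrier K" "\<alpha> \<in> Bij (carrier K)"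
    if "\<alpha> \<in> auto K" for \<alpha> x and K :: "('z, 'y) monoid_scheme"
    using that by (auto simp: auto_def Bij_def dest: bij_betwE)
  let ?c = "\<lambda>\<alpha>. \<lambda>y\<in>carrier H. h (\<alpha> (k y))"
  let ?d = "\<lambda>\<beta>. \<lambda>x\<in>carrier G. k (\<beta> (h x))"
  have "?d (?c \<alpha>) = \<alpha>" if "\<alpha> \<in> auto G" for \<alpha>
    by (rule extensionalityI[of _ "carrier G"]) (use mem[OF that] in \<open>auto simp: h k kh hk\<close>)
  moreover have "?c (?d \<beta>) = \<beta>" if "\<beta> \<in> auto H" for \<beta>
    by (rule extensionalityI[of _ "carrier H"]) (use mem[OF that] in \<open>auto simp: h k kh hk\<close>)
  ultimately have "bij_betw ?c (auto G) (auto H)"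
    using conj_auto[OF assms(2) iso] conj_auto[OF assms(1) iso'] by (intro bij_betw_byWitness[where f' = ?d]) auto
  moreover have "?c \<in> hom (AutoGroup G) (AutoGroup H)"
  proof (rule homI)
    fix \<alpha> \<beta> assume ab: "\<alpha> \<in> carrier (AutoGroup G)" "\<beta> \<in> carrier (AutoGroup G)"
    then have ab: "\<alpha> \<in> auto G" "\<beta> \<in> auto G" by (simp_all add: AutoGroup_def)
    have "?c (compose (carrier G) \<alpha> \<beta>) = compose (carrier H) (?c \<alpha>) (?c \<beta>)"
      using mem[OF ab(1)] mem[OF ab(2)] by (auto simp: compose_def h k kh fun_eq_iff)
    then show "?c (\<alpha> \<otimes>\<^bsub>AutoGroup G\<^esub> \<beta>) = ?c \<alpha> \<otimes>\<^bsub>AutoGroup H\<^esub> ?c \<beta>"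
      using mem(3)[OF ab(1)] mem(3)[OF ab(2)] mem(3)[OF conj_auto[OF assms(2) iso ab(1)]]
        mem(3)[OF conj_auto[OF assms(2) iso ab(2)]]
      by (simp add: AutoGroup_def BijGroup_def)
  qed (use conj_auto[OF assms(2) iso] in \<open>auto simp: AutoGroup_def\<close>)
  ultimately show ?thesis
    by (intro is_isoI[of ?c] isoI) (simp_all add: AutoGroup_def)
qed

text \<open>With \<open>N = carrier PT4\<close> this map is \<open>phi4\<close>. Conjugation by
  \<open>inv g\<close> supplies the inverse bijection.\<close>

lemma (in group) conj_action_hom:
  assumes "N \<lhd> G"
  shows "(\<lambda>g. \<lambda>h\<in>N. g \<otimes> h \<otimes> inv g) \<in> hom G (AutoGroup (G\<lparr>carrier := N\<rparr>))"
proof -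
  interpret N: normal N G by fact
  have mem: "g \<otimes> h \<otimes> inv g \<in> N" if "g \<in> carrier G" "h \<in> N" for g h
    using that by (simp add: N.inv_op_closed2)
  let ?c = "\<lambda>g. \<lambda>h\<in>N. g \<otimes> h \<otimes> inv g"
  have assoc_cancel: "g \<otimes> (inv g \<otimes> h) = h" "inv g \<otimes> (g \<otimes> h) = h"
    if "g \<in> carrier G" "h \<in> carrier G" for g h
    using that by (simp_all add: m_assoc[symmetric])
  have cancel: "inv g \<otimes> (g \<otimes> h \<otimes> inv g) \<otimes> inv (inv g) = h" "g \<otimes> (inv g \<otimes> h \<otimes> inv (inv g)) \<otimes> inv g = h"
    if "g \<in> carrier G" "h \<in> N" for g h
    using that by (simp_all add: m_assoc assoc_cancel)
  have bij: "bij_betw (?c g) N N" if "g \<in> carrier G" for g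
    using that mem[of g] mem[of "inv g"] cancel
    by (intro bij_betw_byWitness[where f' = "?c (inv g)"]) auto
  have conj_mult: "g \<otimes> (h \<otimes> h') \<otimes> inv g = (g \<otimes> h \<otimes> inv g) \<otimes> (g \<otimes> h' \<otimes> inv g)"
    if "g \<in> carrier G" "h \<in> N" "h' \<in> N" for g h h'
    using that by (simp add: m_assoc assoc_cancel)
  have auto: "?c g \<in> auto (G\<lparr>carrier := N\<rparr>)" if "g \<in> carrier G" for g
    unfolding auto_def Bij_def using bij[OF that] mem that
    by (auto intro!: homI simp: conj_mult)
  show ?thesis
  proof (rule homI)
    fix g g' assume g: "g \<in> carrier G" "g' \<in> carrier G"
    have "?c (g \<otimes> g') = compose N (?c g) (?c g')"
      using g mem by (auto simp: compose_def fun_eq_iff inv_mult_group m_assoc)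
    then show "?c (g \<otimes> g') = ?c g \<otimes>\<^bsub>AutoGroup (G\<lparr>carrier := N\<rparr>)\<^esub> ?c g'"
      using g auto by (auto simp: AutoGroup_def BijGroup_def auto_def)
  qed (use auto in \<open>auto simp: AutoGroup_def\<close>)
qed

text \<open>The letter \<open>1\<close> must not turn into \<open>Suc 0\<close> when words are
  evaluated.\<close>

declare One_nat_def [simp del]

section \<open>Words in the twin group\<close>

lemma fold_word_eq_T4:
  assumes "word_eq T4_gens T4_rels v w" "x \<in> X"
    and closed: "\<And>i x. i \<in> T4_gens \<Longrightarrow> x \<in> X \<Longrightarrow> A i x \<in> X"
    and invol: "\<And>i x. i \<in> T4_gens \<Longrightarrow> x \<in> X \<Longrightarrow> A i (A i x) = x"
    and comm: "\<And>x. x \<in> X \<Longrightarrow> A 3 (A 1 x) = A 1 (A 3 x)"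
  shows "fold A (map fst v) x = fold A (map fst w) x"
proof -
  have mem: "fold A (map fst w) x \<in> X" if "w \<in> gwords T4_gens" "x \<in> X" for w x
    using that by (induction w arbitrary: x) (auto simp: closed)
  show ?thesis using assms(1,2)
  proof (induction arbitrary: x rule: word_eq.induct)
    case (cancel u v i b)
    then show ?case using mem[of u x] by (simp add: invol)
  next
    case (rel u v l r)
    define y where "y = fold A (map fst u) x"
    have "y \<in> X" using mem rel by (simp add: y_def)
    then have "A 1 (A 1 y) = y" "A 2 (A 2 y) = y" "A 3 (A 3 y) = y" "A 3 (A 1 y) = A 1 (A 3 y)"
      using invol comm by (simp_all add: T4_gens_def)
    then have "fold A (map fst l) y = fold A (map fst r) y"
      using rel by (auto simp: T4_rels_def)
    then show ?case by (simp add: y_def)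
  qed auto
qed

text \<open>Every generator is an involution, so positive words already represent all
  elements.\<close>

definition T4_prod :: "nat list \<Rightarrow> nat gword set" where
  "T4_prod u = word_class T4_gens T4_rels (map (\<lambda>i. (i, True)) u)"

lemma map_True_gwords [simp]: "map (\<lambda>i. (i, True)) u \<in> gwords S \<longleftrightarrow> u \<in> lists S"
  by (induction u) auto

lemma rev_in_lists_iff [simp]: "rev u \<in> lists S \<longleftrightarrow> u \<in> lists S"
  by (simp add: in_lists_conv_set)

lemma T4_prod_closed [simp]: "u \<in> lists T4_gens \<Longrightarrow> T4_prod u \<in> carrier T4"
  by (auto simp: T4_prod_def T4_def presented_group_def)

lemma T4_prod_append:
  "u \<in> lists T4_gens \<Longrightarrow> v \<in> lists T4_gens \<Longrightarrow> T4_prod (u @ v) = T4_prod u \<otimes>\<^bsub>T4\<^esub> T4_prod v"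
  by (simp add: T4_prod_def T4_def presented_group_mult)

lemma T4_prod_Nil [simp]: "T4_prod [] = \<one>\<^bsub>T4\<^esub>"
  by (simp add: T4_prod_def T4_def presented_group_def)

lemma T4_prod_Cons:
  "i \<in> T4_gens \<Longrightarrow> v \<in> lists T4_gens \<Longrightarrow> T4_prod (i # v) = T4_prod [i] \<otimes>\<^bsub>T4\<^esub> T4_prod v"
  using T4_prod_append[of "[i]" v] by simp

lemma T4_prod_eqI:
  assumes "(map (\<lambda>i. (i, True)) l, map (\<lambda>i. (i, True)) r) \<in> T4_rels" "l \<in> lists T4_gens" "r \<in> lists T4_gens"
  shows "T4_prod l = T4_prod r"
  using word_eq.rel[of "[]" T4_gens "[]" _ _ T4_rels] assms by (simp add: T4_prod_def word_class_eq_iff)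

lemma T4_prod_invol: "i \<in> T4_gens \<Longrightarrow> T4_prod [i] \<otimes>\<^bsub>T4\<^esub> T4_prod [i] = \<one>\<^bsub>T4\<^esub>"
  using T4_prod_eqI[of "[i, i]" "[]"] T4_prod_Cons[of i "[i]"] by (auto simp: T4_rels_def T4_gens_def)

lemma T4_prod_comm: "T4_prod [1] \<otimes>\<^bsub>T4\<^esub> T4_prod [3] = T4_prod [3] \<otimes>\<^bsub>T4\<^esub> T4_prod [1]"
  using T4_prod_eqI[of "[1, 3]" "[3, 1]"] T4_prod_Cons[of 1 "[3]"] T4_prod_Cons[of 3 "[1]"]
  by (auto simp: T4_rels_def T4_gens_def)

interpretation T4: group T4
  by (rule group_T4)

lemma T4_prod_inv: "u \<in> lists T4_gens \<Longrightarrow> inv\<^bsub>T4\<^esub> T4_prod u = T4_prod (rev u)"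
proof (induction u)
  case (Cons i u)
  then have "inv\<^bsub>T4\<^esub> T4_prod [i] = T4_prod [i]"
    by (intro T4.inv_equality) (auto simp: T4_prod_invol)
  then show ?case
    using Cons T4_prod_append[of "[i]" u] T4_prod_append[of "rev u" "[i]"] by (simp add: T4.inv_mult_group)
qed simp

lemma word_eq_T4_True:
  "w \<in> gwords T4_gens \<Longrightarrow> word_eq T4_gens T4_rels w (map (\<lambda>i. (i, True)) (map fst w))"
proof (induction w)
  case Nil
  then show ?case by (auto intro: word_eq.refl)
next
  case (Cons p w)
  obtain i b where p: "p = (i, b)" by fastforce
  then have i: "i \<in> T4_gens" using Cons.prems by simp
  \<comment> \<open>Both sides equal s^-1 s s: drop the square s s, or cancel s^-1 s.\<close>
  have "word_eq T4_gens T4_rels [(i, False)] [(i, True)]"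
  proof (rule word_eq.trans[OF word_eq.sym])
    show "word_eq T4_gens T4_rels [(i, False), (i, True), (i, True)] [(i, False)]"
      using word_eq.rel[of "[(i, False)]" T4_gens "[]" "[(i, True), (i, True)]" "[]" T4_rels] i
      by (auto simp: T4_rels_def T4_gens_def)
    show "word_eq T4_gens T4_rels [(i, False), (i, True), (i, True)] [(i, True)]"
      using word_eq.cancel[of "[]" T4_gens "[(i, True)]" i T4_rels False] i by simp
  qed
  then have "word_eq T4_gens T4_rels [p] [(i, True)]"
    using i p by (cases b) (auto intro: word_eq.refl)
  then show ?case
    using word_eq_append[of T4_gens T4_rels "[p]" "[(i, True)]" w] Cons p by simp
qed

lemma T4_prod_cases:
  assumes "g \<in> carrier T4"
  obtains u where "u \<in> lists T4_gens" "g = T4_prod u"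
proof -
  obtain w where w: "w \<in> gwords T4_gens" "g = word_class T4_gens T4_rels w"
    using assms by (auto simp: T4_def presented_group_def)
  then have "g = T4_prod (map fst w)" "map fst w \<in> lists T4_gens"
    using word_eq_T4_True[OF w(1)] by (force simp: T4_prod_def word_class_eq_iff gwords_def)+
  then show ?thesis using that by blast
qed

lemma fold_T4_prod_cong:
  assumes "T4_prod u = T4_prod v" "u \<in> lists T4_gens" "x \<in> X"
    and "\<And>i x. i \<in> T4_gens \<Longrightarrow> x \<in> X \<Longrightarrow> A i x \<in> X"
    and "\<And>i x. i \<in> T4_gens \<Longrightarrow> x \<in> X \<Longrightarrow> A i (A i x) = x"
    and "\<And>x. x \<in> X \<Longrightarrow> A 3 (A 1 x) = A 1 (A 3 x)"
  shows "fold A u x = fold A v x"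
proof -
  have "word_eq T4_gens T4_rels (map (\<lambda>i. (i, True)) u) (map (\<lambda>i. (i, True)) v)"
    using assms(1,2) by (simp add: T4_prod_def word_class_eq_iff)
  from fold_word_eq_T4[OF this assms(3-)] show ?thesis
    by (simp add: o_def)
qed

lemma T4_prod_singleton: "T4_prod [i] = T4_gen i"
  by (simp add: T4_prod_def T4_gen_def)

text \<open>In this form the image in the symmetric group is the first component of the
  \<open>rstep\<close> action.\<close>

lemma T4_to_S4_prod:
  "u \<in> lists T4_gens \<Longrightarrow> T4_to_S4 (T4_prod u) = fold (\<lambda>i \<sigma>. \<sigma> \<circ> transpose i (i + 1)) u id"
proof (induction u rule: rev_induct)
  case Nil
  then show ?case
    using hom_one[OF T4_to_S4_hom group_T4 sym_group_is_group] by (simp add: sym_group_one)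
next
  case (snoc i u)
  then have "T4_to_S4 (T4_prod (u @ [i])) = T4_to_S4 (T4_prod u) \<circ> T4_to_S4 (T4_gen i)"
    using hom_mult[OF T4_to_S4_hom, of "T4_prod u" "T4_prod [i]"] T4_prod_append[of u "[i]"]
      T4_prod_closed[of "[i]"]
    by (simp add: sym_group_mult T4_prod_singleton)
  then show ?case using snoc by (simp add: T4_to_S4_gen)
qed

section \<open>Normal forms\<close>

text \<open>Words are processed from the left, so a list acts as a stack: it is the reversal of the word
  it represents. The commuting letters are ordered so that \<open>13\<close> is pushed as \<open>[1, 3]\<close>, never as
  \<open>[3, 1]\<close>.\<close>

fun push :: "nat \<Rightarrow> nat list \<Rightarrow> nat list" where
  "push i [] = [i]"
| "push i (j # w) = (if i = j then w else if i = 3 \<and> j = 1 then j # push i w else i # j # w)"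

abbreviation reduced :: "nat list \<Rightarrow> bool" where
  "reduced \<equiv> successively (\<lambda>i j. i \<noteq> j \<and> (i, j) \<noteq> (3, 1))"

definition normal_forms :: "nat list set" where
  "normal_forms = {w \<in> lists T4_gens. reduced w}"

lemma push_reduced: "reduced (i # w) \<Longrightarrow> push i w = i # w"
  by (cases w) auto

lemma push_lists: "i \<in> S \<Longrightarrow> w \<in> lists S \<Longrightarrow> push i w \<in> lists S"
  by (induction i w rule: push.induct) auto

lemma push_normal_forms:
  assumes "i \<in> T4_gens" "w \<in> normal_forms"
  shows "push i w \<in> normal_forms"
proof -
  \<comment> \<open>The second conjunct is for the swap: when \<open>3\<close> passes below a top
    letter \<open>1\<close>, that \<open>1\<close> returns to the top of \<open>push 3 w\<close> and
    must not meet another \<open>1\<close>.\<close>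
  have "reduced w \<Longrightarrow> reduced (push i w) \<and>
      (i = 3 \<longrightarrow> w = [] \<or> hd w \<noteq> 1 \<longrightarrow> push i w = [] \<or> hd (push i w) \<noteq> 1)"
    by (induction i w rule: push.induct) (auto simp: successively_Cons)
  with assms show ?thesis by (simp add: normal_forms_def push_lists)
qed

lemma push_push:
  assumes "w \<in> normal_forms" shows "push i (push i w) = w"
proof -
  have "reduced w \<Longrightarrow> push i (push i w) = w" for w
    by (induction i w rule: push.induct) (auto simp: successively_Cons push_reduced)
  with assms show ?thesis by (simp add: normal_forms_def)
qed

lemma push_comm:
  assumes "w \<in> normal_forms" shows "push 3 (push 1 w) = push 1 (push 3 w)"
  using assms by (cases w) (auto simp: successively_Cons normal_forms_def push_reduced)

lemma length_push: "length (push i w) \<le> Suc (length w)"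
  by (induction i w rule: push.induct) auto

lemma length_fold_push: "length (fold push u w) \<le> length u + length w"
proof (induction u arbitrary: w)
  case (Cons i u)
  show ?case using Cons[of "push i w"] length_push[of i w] by simp
qed simp

text \<open>Van der Waerden's argument: \<open>T4\<close> acts on the set of normal forms, so
  pushing a word onto a stack depends only on the group element. From the empty stack this gives
  uniqueness of normal forms.\<close>

lemma fold_push_cong:
  "T4_prod u = T4_prod v \<Longrightarrow> u \<in> lists T4_gens \<Longrightarrow> w \<in> normal_forms \<Longrightarrow> fold push u w = fold push v w"
  using push_comm
  by (intro fold_T4_prod_cong[of u v w normal_forms]) (auto simp: push_normal_forms push_push)

lemma fold_push_reduced: "reduced (rev u @ w) \<Longrightarrow> fold push u w = rev u @ w"
proof (induction u arbitrary: w)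
  case (Cons i u)
  then have "reduced (i # w)" by (auto simp: successively_append_iff)
  then show ?case using Cons by (simp add: push_reduced)
qed simp

text \<open>The top of the stack is the last letter of the word, so pushing is right
  multiplication.\<close>

lemma T4_prod_rev_push:
  assumes "i \<in> T4_gens" "w \<in> lists T4_gens"
  shows "T4_prod (rev (push i w)) = T4_prod (rev w) \<otimes>\<^bsub>T4\<^esub> T4_prod [i]"
  using assms
proof (induction i w rule: push.induct)
  case (2 i j w)
  let ?w = "T4_prod (rev w)"
  have "T4_prod (rev (j # w)) \<otimes>\<^bsub>T4\<^esub> T4_prod [i] = ?w \<otimes>\<^bsub>T4\<^esub> (T4_prod [j] \<otimes>\<^bsub>T4\<^esub> T4_prod [i])"
    using 2 by (simp add: T4_prod_append T4.m_assoc)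
  moreover have "?w \<otimes>\<^bsub>T4\<^esub> T4_prod [3] \<otimes>\<^bsub>T4\<^esub> T4_prod [1] = ?w \<otimes>\<^bsub>T4\<^esub> (T4_prod [1] \<otimes>\<^bsub>T4\<^esub> T4_prod [3])"
    if "i = 3" "j = 1"
    using 2 that by (simp only: T4_prod_comm) (simp add: T4.m_assoc)
  ultimately show ?case
    using 2 push_lists[of i T4_gens w] T4_prod_append[of "rev w @ [j]" "[i]"] T4_prod_append[of "rev (push i w)" "[j]"]
    by (auto simp: T4_prod_invol T4.m_assoc)
qed simp

lemma T4_normal_form:
  assumes "g \<in> carrier T4"
  obtains w where "rev w \<in> normal_forms" "g = T4_prod w"
proof -
  obtain u where u: "u \<in> lists T4_gens" "g = T4_prod u"
    using T4_prod_cases[OF assms] .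
  have "fold push u [] \<in> normal_forms \<and> T4_prod (rev (fold push u [])) = T4_prod u"
    using u(1)
  proof (induction u rule: rev_induct)
    case (snoc i u)
    then show ?case
      using push_normal_forms[of i "fold push u []"] T4_prod_rev_push[of i "fold push u []"]
        T4_prod_append[of u "[i]"] by (simp add: normal_forms_def)
  qed (simp add: normal_forms_def)
  then show ?thesis using that[of "rev (fold push u [])"] u(2) by simp
qed

section \<open>Cancellation and commutation of normal forms\<close>

text \<open>After \<open>u\<close> the stack is \<open>rev u\<close>. The first letter of
  \<open>v\<close> removes its top, and the remaining letters of \<open>v\<close> add at most one
  entry each.\<close>

lemma fold_push_cancel:
  assumes u: "rev u \<in> normal_forms" and v: "v \<noteq> []" and uv: "u \<noteq> []" "last u = hd v"
  shows "length (fold push (u @ v) []) < length u + length v"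
proof -
  obtain u' i where u': "u = u' @ [i]" using uv(1) by (cases u rule: rev_cases) auto
  obtain v' where v': "v = i # v'" using v uv u' by (cases v) auto
  have "fold push u [] = rev u"
    using u fold_push_reduced[of u "[]"] by (simp add: normal_forms_def)
  then have "fold push (u @ v) [] = fold push v' (rev u')"
    by (simp only: fold_append o_apply) (simp add: u' v')
  then show ?thesis using length_fold_push[of v' "rev u'"] by (simp add: u' v')
qed

text \<open>Exactly one of the two letters at the junction is \<open>2\<close>, so they lie in
  different free factors and neither cancel nor swap.\<close>

lemma fold_push_append:
  assumes "rev u \<in> normal_forms" "rev v \<in> normal_forms" "last u = 2 \<longleftrightarrow> hd v \<noteq> 2"
  shows "fold push (u @ v) [] = rev (u @ v)"
proof -
  have "reduced (rev (u @ v))"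
    using assms by (auto simp: normal_forms_def successively_append_iff last_rev hd_rev
      simp del: successively_rev)
  then show ?thesis using fold_push_reduced[of "u @ v" "[]"] by simp
qed

text \<open>If \<open>w\<close> starts with \<open>2\<close> but does not end with \<open>2\<close>, or vice versa, then one of \<open>w h\<close>, \<open>h w\<close>
  is a normal form and the other is not, so their lengths differ. Otherwise \<open>h\<close> or \<open>h'\<close> yields
  normal forms on both sides, with different first letters.\<close>

lemma T4_commuting_trivial:
  assumes g: "g \<in> carrier T4"
    and h: "rev h \<in> normal_forms" "h \<noteq> []" "hd h = 2" "last h = 2"
    and h': "rev h' \<in> normal_forms" "h' \<noteq> []" "hd h' \<noteq> 2" "last h' \<noteq> 2"
    and comm: "g \<otimes>\<^bsub>T4\<^esub> T4_prod h = T4_prod h \<otimes>\<^bsub>T4\<^esub> g" "g \<otimes>\<^bsub>T4\<^esub> T4_prod h' = T4_prod h' \<otimes>\<^bsub>T4\<^esub> g"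
  shows "g = \<one>\<^bsub>T4\<^esub>"
proof (rule ccontr)
  assume "g \<noteq> \<one>\<^bsub>T4\<^esub>"
  obtain w where w: "rev w \<in> normal_forms" "g = T4_prod w"
    using T4_normal_form[OF g] .
  with \<open>g \<noteq> \<one>\<^bsub>T4\<^esub>\<close> have ne: "w \<noteq> []" by auto
  have eq: "fold push (w @ k) [] = fold push (k @ w) []"
    if "rev k \<in> normal_forms" "T4_prod w \<otimes>\<^bsub>T4\<^esub> T4_prod k = T4_prod k \<otimes>\<^bsub>T4\<^esub> T4_prod w" for k
  proof (rule fold_push_cong)
    show "T4_prod (w @ k) = T4_prod (k @ w)"
      using that w by (simp add: normal_forms_def T4_prod_append)
  qed (use that w in \<open>simp_all add: normal_forms_def\<close>)
  have eq_h: "fold push (w @ h) [] = fold push (h @ w) []"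
    and eq_h': "fold push (w @ h') [] = fold push (h' @ w) []"
    using eq h(1) h'(1) comm w(2) by auto
  consider "hd w = 2" "last w = 2" | "hd w \<noteq> 2" "last w \<noteq> 2" | "hd w = 2" "last w \<noteq> 2"
    | "hd w \<noteq> 2" "last w = 2" by blast
  then show False
  proof cases
    case 1
    then have "fold push (w @ h') [] = rev (w @ h')" "fold push (h' @ w) [] = rev (h' @ w)"
      using h' w fold_push_append[of w h'] fold_push_append[of h' w] by simp_all
    then have "hd (w @ h') = hd (h' @ w)" using eq_h' by (metis rev_is_rev_conv)
    then show False using 1 ne h' by simp
  next
    case 2
    then have "fold push (w @ h) [] = rev (w @ h)" "fold push (h @ w) [] = rev (h @ w)"
      using h w fold_push_append[of w h] fold_push_append[of h w] by simp_all
    then have "hd (w @ h) = hd (h @ w)" using eq_h by (metis rev_is_rev_conv)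
    then show False using 2 ne h by simp
  next
    case 3
    have "length (fold push (w @ h) []) = length w + length h"
      by (subst fold_push_append) (use 3 h w in simp_all)
    then show False using fold_push_cancel[of h w] 3 h ne eq_h by simp
  next
    case 4
    have "length (fold push (h @ w) []) = length h + length w"
      by (subst fold_push_append) (use 4 h w in simp_all)
    then show False using fold_push_cancel[of w h] 4 h ne eq_h w by simp
  qed
qed

section \<open>The Reidemeister--Schreier action\<close>

abbreviation F7 :: "nat gword set monoid" where
  "F7 \<equiv> free_group {1..7}"

interpretation F7: group F7
  by (simp add: free_group_def group_presented_group)

definition F7_gen :: "nat \<Rightarrow> nat gword set" where
  "F7_gen k = word_class {1..7} {} [(k, True)]"

lemma F7_gen_closed: "1 \<le> k \<Longrightarrow> k \<le> 7 \<Longrightarrow> F7_gen k \<in> carrier F7"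
  by (auto simp: F7_gen_def free_group_def presented_group_def)

text \<open>The coset of \<open>\<sigma>\<close> is the set \<open>{\<sigma> 1, \<sigma> 2}\<close>, and \<open>s\<^sub>2\<close> replaces it by \<open>{\<sigma> 1, \<sigma> 3}\<close>. The unoriented
  edge is thus determined by \<open>\<sigma> 1\<close> and \<open>\<sigma> 4\<close>, and its orientation by the order of \<open>\<sigma> 2\<close> and \<open>\<sigma> 3\<close>.
  Label 0 marks the edges of the spanning tree.\<close>

definition edge_label :: "nat \<Rightarrow> nat \<Rightarrow> nat" where
  "edge_label a d = (if (a, d) = (1, 2) then 1 else if (a, d) = (2, 1) then 2
     else if (a, d) = (3, 1) then 3 else if (a, d) = (3, 4) then 4 else if (a, d) = (4, 1) then 5
     else if (a, d) = (4, 2) then 6 else if (a, d) = (4, 3) then 7 else 0)"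

definition edge_value :: "(nat \<Rightarrow> nat) \<Rightarrow> nat gword set" where
  "edge_value \<sigma> = (let k = edge_label (\<sigma> 1) (\<sigma> 4) in
     if k = 0 then \<one>\<^bsub>F7\<^esub> else if \<sigma> 2 < \<sigma> 3 then F7_gen k else inv\<^bsub>F7\<^esub> F7_gen k)"

lemma edge_label_le: "edge_label a d \<le> 7"
  by (simp add: edge_label_def)

lemma edge_value_closed: "edge_value \<sigma> \<in> carrier F7"
  using F7_gen_closed edge_label_le by (auto simp: edge_value_def Let_def)

fun rstep :: "nat \<Rightarrow> (nat \<Rightarrow> nat) \<times> nat gword set \<Rightarrow> (nat \<Rightarrow> nat) \<times> nat gword set" where
  "rstep i (\<sigma>, f) = (\<sigma> \<circ> transpose i (i + 1), if i = 2 then f \<otimes>\<^bsub>F7\<^esub> edge_value \<sigma> else f)"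

definition rstates :: "((nat \<Rightarrow> nat) \<times> nat gword set) set" where
  "rstates = {\<sigma>. \<sigma> permutes {1..4}} \<times> carrier F7"

lemma permutes_comp_transpose:
  "\<sigma> permutes {1..4::nat} \<Longrightarrow> i \<in> T4_gens \<Longrightarrow> \<sigma> \<circ> transpose i (i + 1) permutes {1..4}"
  by (intro permutes_compose permutes_swap_id) (auto simp: T4_gens_def)

lemma permutes_4_values:
  assumes "\<sigma> permutes {1..4::nat}"
  shows "{\<sigma> 1, \<sigma> 2, \<sigma> 3, \<sigma> 4} \<subseteq> {1, 2, 3, 4}" "distinct [\<sigma> 1, \<sigma> 2, \<sigma> 3, \<sigma> 4]"
proof -
  have "\<sigma> i \<in> {1..4}" if "i \<in> {1..4}" for i
    using that permutes_in_image[OF assms] by blast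
  moreover have "{1..4} = {1, 2, 3, 4::nat}" by auto
  ultimately show "{\<sigma> 1, \<sigma> 2, \<sigma> 3, \<sigma> 4} \<subseteq> {1, 2, 3, 4}" by simp
  show "distinct [\<sigma> 1, \<sigma> 2, \<sigma> 3, \<sigma> 4]"
    using permutes_inj[OF assms] by (simp add: inj_eq)
qed

text \<open>The transposition fixes the positions 1 and 4 that determine the label and reverses the
  orientation. Hence crossing an edge and returning multiplies by the identity, which makes
  \<open>rstep 2\<close> an involution.\<close>

lemma edge_value_rev:
  assumes "\<sigma> permutes {1..4}"
  shows "edge_value (\<sigma> \<circ> transpose 2 3) = inv\<^bsub>F7\<^esub> edge_value \<sigma>"
proof -
  have "\<sigma> 2 \<noteq> \<sigma> 3" using permutes_4_values(2)[OF assms] by simp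
  moreover have "transpose 2 3 1 = (1::nat)" "transpose 2 3 4 = (4::nat)"
    by (simp_all add: transpose_def)
  ultimately show ?thesis
    using F7_gen_closed edge_label_le by (auto simp: edge_value_def Let_def)
qed

lemma rstep_closed: "i \<in> T4_gens \<Longrightarrow> x \<in> rstates \<Longrightarrow> rstep i x \<in> rstates"
  using permutes_comp_transpose[of "fst x" i] edge_value_closed
  by (cases x) (auto simp: rstates_def)

lemma rstep_invol:
  assumes "i \<in> T4_gens" "x \<in> rstates"
  shows "rstep i (rstep i x) = x"
proof -
  obtain \<sigma> f where x: "x = (\<sigma>, f)" "\<sigma> permutes {1..4}" "f \<in> carrier F7"
    using assms(2) by (auto simp: rstates_def)
  have "f \<otimes>\<^bsub>F7\<^esub> edge_value \<sigma> \<otimes>\<^bsub>F7\<^esub> edge_value (\<sigma> \<circ> transpose 2 3) = f"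
    using x edge_value_closed by (simp add: edge_value_rev F7.m_assoc)
  then show ?thesis by (simp add: x(1) comp_assoc)
qed

lemma rstep_comm: "rstep 3 (rstep 1 x) = rstep 1 (rstep 3 x)"
  by (cases x) (auto simp: fun_eq_iff transpose_def)

lemma fold_rstep_closed: "u \<in> lists T4_gens \<Longrightarrow> x \<in> rstates \<Longrightarrow> fold rstep u x \<in> rstates"
  by (induction u arbitrary: x) (auto simp: rstep_closed)

lemma fold_rstep_rev:
  "u \<in> lists T4_gens \<Longrightarrow> x \<in> rstates \<Longrightarrow> fold rstep (rev u) (fold rstep u x) = x"
  by (induction u arbitrary: x) (auto simp: rstep_closed rstep_invol fold_rstep_closed)

lemma fold_rstep_cong:
  "T4_prod u = T4_prod v \<Longrightarrow> u \<in> lists T4_gens \<Longrightarrow> x \<in> rstates \<Longrightarrow> fold rstep u x = fold rstep v x"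
  using rstep_comm
  by (intro fold_T4_prod_cong[of u v x rstates]) (auto simp: rstep_closed rstep_invol)

lemma fst_fold_rstep: "fst (fold rstep u x) = fold (\<lambda>i \<sigma>. \<sigma> \<circ> transpose i (i + 1)) u (fst x)"
proof (induction u arbitrary: x)
  case (Cons i u)
  then show ?case by (cases x) simp
qed simp

section \<open>Schreier transversal and generators\<close>

text \<open>The path in the spanning tree from \<open>{1, 2}\<close> to \<open>{a, b}\<close>.\<close>

definition base_word :: "nat \<Rightarrow> nat \<Rightarrow> nat list" where
  "base_word a b = (if (a, b) = (1, 3) then [2] else if (a, b) = (2, 3) then [1, 2]
     else if (a, b) = (1, 4) then [3, 2] else if (a, b) = (2, 4) then [1, 3, 2]
     else if (a, b) = (3, 4) then [2, 1, 3, 2] else [])"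

text \<open>The arguments are the values of a permutation at 1, 2, 3, 4. Each base word ends at a
  permutation increasing on the positions 1, 2 and on 3, 4; the final letters \<open>1\<close> and
  \<open>3\<close> correct the order inside each pair.\<close>

definition transversal :: "nat \<Rightarrow> nat \<Rightarrow> nat \<Rightarrow> nat \<Rightarrow> nat list" where
  "transversal a b c d = base_word (min a b) (max a b)
     @ (if a < b then [] else [1]) @ (if c < d then [] else [3])"

text \<open>For the edge with label \<open>k\<close> from \<open>\<sigma>\<close> to \<open>\<sigma> s\<^sub>2\<close>, oriented such that \<open>\<sigma> 2 < \<sigma> 3\<close>, this is the Schreier
  generator \<open>t s\<^sub>2 t'\<^sup>-\<^sup>1\<close>, where \<open>t\<close> and \<open>t'\<close> are the transversal words of \<open>\<sigma>\<close> and \<open>\<sigma> s\<^sub>2\<close>.\<close>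

definition gen_word :: "nat \<Rightarrow> nat list" where
  "gen_word k = [[2,3,2,3,2,3], [1,2,3,2,3,2,3,1], [1,2,1,3,2,3,2,3,1,2], [2,1,2,1,2,1],
     [1,3,2,1,3,2,3,1,2,3,1,2], [3,2,1,3,2,1,2,3,1,2], [3,2,1,2,1,2,3,1]] ! (k - 1)"

lemma base_word_lists: "base_word a b \<in> lists T4_gens"
  by (simp add: base_word_def T4_gens_def)

lemma transversal_lists: "transversal a b c d \<in> lists T4_gens"
  by (simp add: transversal_def base_word_lists) (simp add: T4_gens_def)

lemma atLeastAtMost_1_7: "{1..7::nat} = {1, 2, 3, 4, 5, 6, 7}"
  by auto

lemma gen_word_simps:
  "gen_word 1 = [2,3,2,3,2,3]" "gen_word 2 = [1,2,3,2,3,2,3,1]"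
  "gen_word 3 = [1,2,1,3,2,3,2,3,1,2]" "gen_word 4 = [2,1,2,1,2,1]"
  "gen_word 5 = [1,3,2,1,3,2,3,1,2,3,1,2]" "gen_word 6 = [3,2,1,3,2,1,2,3,1,2]"
  "gen_word 7 = [3,2,1,2,1,2,3,1]"
  by (simp_all add: gen_word_def nth_Cons')

lemma gen_word_lists: "k \<in> {1..7} \<Longrightarrow> gen_word k \<in> lists T4_gens"
  unfolding atLeastAtMost_1_7 by (auto simp: gen_word_simps T4_gens_def)

lemma gen_word_edge:
  assumes "{a, b, c, d} \<subseteq> {1, 2, 3, 4}" "distinct [a, b, c, d]" "b < c"
  shows "if edge_label a d = 0 then transversal a c b d = transversal a b c d @ [2]
    else gen_word (edge_label a d) = transversal a b c d @ [2] @ rev (transversal a c b d)"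
proof -
  have "a = 1 \<or> a = 2 \<or> a = 3 \<or> a = 4" "b = 1 \<or> b = 2 \<or> b = 3 \<or> b = 4"
    "c = 1 \<or> c = 2 \<or> c = 3 \<or> c = 4" "d = 1 \<or> d = 2 \<or> d = 3 \<or> d = 4"
    using assms(1) by simp_all
  \<comment> \<open>With \<open>b < c\<close> each of the 12 edges occurs once, in its positive
    orientation; 5 of them belong to the tree.\<close>
  then have "(a, b, c, d) \<in> {(1,2,3,4), (1,2,4,3), (1,3,4,2), (2,1,3,4), (2,1,4,3), (2,3,4,1),
      (3,1,2,4), (3,1,4,2), (3,2,4,1), (4,1,2,3), (4,1,3,2), (4,2,3,1)}"
    using assms(2,3) by (elim disjE) simp_all
  then show ?thesis
    by (elim insertE) (simp_all add: edge_label_def transversal_def base_word_def gen_word_simps)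
qed

section \<open>The homomorphism from the free group to \<open>T4\<close>\<close>

definition gen_map :: "nat gword set \<Rightarrow> nat gword set" where
  "gen_map = pres_lift T4 (\<lambda>k. T4_prod (gen_word k))"

lemma gen_map_hom: "gen_map \<in> hom F7 T4"
  unfolding gen_map_def free_group_def
  by (rule T4.pres_lift_hom) (use gen_word_lists in auto)

lemma gen_map_word_class:
  "w \<in> gwords {1..7} \<Longrightarrow> gen_map (word_class {1..7} {} w) = word_eval T4 (\<lambda>k. T4_prod (gen_word k)) w"
  unfolding gen_map_def by (rule T4.pres_lift_word_class) (use gen_word_lists in auto)

interpretation gen_map: group_hom F7 T4 gen_map
  by unfold_locales (rule gen_map_hom)

lemma gen_map_gen: "k \<in> {1..7} \<Longrightarrow> gen_map (F7_gen k) = T4_prod (gen_word k)"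
  using gen_word_lists[of k] by (simp add: F7_gen_def gen_map_word_class)

definition perm_transversal :: "(nat \<Rightarrow> nat) \<Rightarrow> nat gword set" where
  "perm_transversal \<sigma> = T4_prod (transversal (\<sigma> 1) (\<sigma> 2) (\<sigma> 3) (\<sigma> 4))"

lemma perm_transversal_closed [simp]: "perm_transversal \<sigma> \<in> carrier T4"
  by (simp add: perm_transversal_def transversal_lists)

text \<open>If \<sigma> 2 < \<sigma> 3, the generator word t s2 t'^-1 cancels against the
  transversal t' of the endpoint; on a tree edge t' is t s2 itself. The other orientation follows by
  applying this to the reversed edge and inverting its value.\<close>

lemma perm_transversal_edge:
  assumes \<sigma>: "\<sigma> permutes {1..4}"
  shows "gen_map (edge_value \<sigma>) \<otimes>\<^bsub>T4\<^esub> perm_transversal (\<sigma> \<circ> transpose 2 3) =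
    perm_transversal \<sigma> \<otimes>\<^bsub>T4\<^esub> T4_prod [2]"
proof -
  have 2: "2 \<in> T4_gens" by (simp add: T4_gens_def)
  have lt: "gen_map (edge_value \<sigma>) \<otimes>\<^bsub>T4\<^esub> perm_transversal (\<sigma> \<circ> transpose 2 3) =
    perm_transversal \<sigma> \<otimes>\<^bsub>T4\<^esub> T4_prod [2]" if \<sigma>: "\<sigma> permutes {1..4}" "\<sigma> 2 < \<sigma> 3" for \<sigma> :: "nat \<Rightarrow> nat"
  proof -
    let ?k = "edge_label (\<sigma> 1) (\<sigma> 4)"
    let ?t = "transversal (\<sigma> 1) (\<sigma> 2) (\<sigma> 3) (\<sigma> 4)" and ?t' = "transversal (\<sigma> 1) (\<sigma> 3) (\<sigma> 2) (\<sigma> 4)"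
    have t': "perm_transversal (\<sigma> \<circ> transpose 2 3) = T4_prod ?t'"
      by (simp add: perm_transversal_def transpose_def)
    have *: "if ?k = 0 then ?t' = ?t @ [2] else gen_word ?k = ?t @ [2] @ rev ?t'"
      using gen_word_edge[OF permutes_4_values[OF \<sigma>(1)] \<sigma>(2)] .
    show ?thesis
    proof (cases "?k = 0")
      case True
      with * show ?thesis
        unfolding t' using 2 transversal_lists
        by (simp add: perm_transversal_def edge_value_def T4_prod_append)
    next
      case False
      then have "gen_map (edge_value \<sigma>) = T4_prod (?t @ [2]) \<otimes>\<^bsub>T4\<^esub> inv\<^bsub>T4\<^esub> T4_prod ?t'"
        using * \<sigma> edge_label_le 2 transversal_lists T4_prod_append[of "?t @ [2]" "rev ?t'"]
        by (simp add: edge_value_def gen_map_gen T4_prod_inv)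
      then show ?thesis
        unfolding t' using 2 transversal_lists
        by (simp add: perm_transversal_def T4_prod_append T4.m_assoc)
    qed
  qed
  have "\<sigma> 2 \<noteq> \<sigma> 3" using permutes_4_values(2)[OF \<sigma>] by simp
  then consider "\<sigma> 2 < \<sigma> 3" | "\<sigma> 3 < \<sigma> 2" by linarith
  then show ?thesis
  proof cases
    case 1
    then show ?thesis using lt \<sigma> by blast
  next
    case 2
    let ?\<tau> = "\<sigma> \<circ> transpose 2 3" and ?e = "gen_map (edge_value \<sigma>)"
    have "?\<tau> permutes {1..4}" using permutes_comp_transpose[OF \<sigma>, of 2] by (simp add: T4_gens_def)
    moreover have "?\<tau> 2 < ?\<tau> 3" using 2 by simp
    ultimately have "inv\<^bsub>T4\<^esub> ?e \<otimes>\<^bsub>T4\<^esub> perm_transversal \<sigma> = perm_transversal ?\<tau> \<otimes>\<^bsub>T4\<^esub> T4_prod [2]"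
      using lt[of ?\<tau>] edge_value_closed by (simp add: edge_value_rev[OF \<sigma>] comp_assoc)
    then have "perm_transversal \<sigma> = ?e \<otimes>\<^bsub>T4\<^esub> (perm_transversal ?\<tau> \<otimes>\<^bsub>T4\<^esub> T4_prod [2])"
      using edge_value_closed \<open>2 \<in> T4_gens\<close> by (simp add: T4.inv_solve_left')
    then show ?thesis
      using edge_value_closed \<open>2 \<in> T4_gens\<close> by (simp add: T4.m_assoc T4_prod_invol)
  qed
qed

text \<open>Neither letter changes the set {\<sigma> 1, \<sigma> 2}, so the base word stays and only
  one of the two sorting letters toggles. For \<open>i = 1\<close> the new letter first commutes
  past a possible final \<open>3\<close>.\<close>

lemma perm_transversal_13:
  assumes \<sigma>: "\<sigma> permutes {1..4}" and i: "i \<in> {1, 3}"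
  shows "perm_transversal (\<sigma> \<circ> transpose i (i + 1)) = perm_transversal \<sigma> \<otimes>\<^bsub>T4\<^esub> T4_prod [i]"
proof -
  let ?s = "\<lambda>i b. if b then \<one>\<^bsub>T4\<^esub> else T4_prod [i]"
  have gens: "1 \<in> T4_gens" "3 \<in> T4_gens" by (simp_all add: T4_gens_def)
  define B where "B = T4_prod (base_word (min (\<sigma> 1) (\<sigma> 2)) (max (\<sigma> 1) (\<sigma> 2)))"
  have B: "B \<in> carrier T4" by (simp add: B_def base_word_lists)
  have split: "T4_prod (base_word a b @ (if p then [] else [1]) @ (if q then [] else [3])) =
      T4_prod (base_word a b) \<otimes>\<^bsub>T4\<^esub> (?s 1 p \<otimes>\<^bsub>T4\<^esub> ?s 3 q)" for a b p q
    using gens base_word_lists[of a b] T4_prod_append[of "[1]" "[3]"]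
    by (cases p; cases q) (simp_all add: T4_prod_append)
  have t: "perm_transversal \<sigma> = B \<otimes>\<^bsub>T4\<^esub> (?s 1 (\<sigma> 1 < \<sigma> 2) \<otimes>\<^bsub>T4\<^esub> ?s 3 (\<sigma> 3 < \<sigma> 4))"
    unfolding perm_transversal_def transversal_def split B_def ..
  have flip: "?s i p \<otimes>\<^bsub>T4\<^esub> T4_prod [i] = ?s i (\<not> p)" if "i \<in> T4_gens" for i p
    using that by (simp add: T4_prod_invol)
  have not_less: "\<sigma> 2 < \<sigma> 1 \<longleftrightarrow> \<not> \<sigma> 1 < \<sigma> 2" "\<sigma> 4 < \<sigma> 3 \<longleftrightarrow> \<not> \<sigma> 3 < \<sigma> 4"
    using permutes_4_values(2)[OF \<sigma>] by auto
  consider "i = 1" | "i = 3" using i by blast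
  then show ?thesis
  proof cases
    case 1
    have "perm_transversal (\<sigma> \<circ> transpose 1 2) = B \<otimes>\<^bsub>T4\<^esub> (?s 1 (\<not> \<sigma> 1 < \<sigma> 2) \<otimes>\<^bsub>T4\<^esub> ?s 3 (\<sigma> 3 < \<sigma> 4))"
      unfolding perm_transversal_def transversal_def split B_def
      by (simp add: transpose_def not_less(1) min.commute[of "\<sigma> 2"] max.commute[of "\<sigma> 2"])
    moreover have "?s 3 q \<otimes>\<^bsub>T4\<^esub> T4_prod [1] = T4_prod [1] \<otimes>\<^bsub>T4\<^esub> ?s 3 q" for q
      using gens by (simp add: T4_prod_comm)
    ultimately show ?thesis
      using 1 B gens flip[OF gens(1), of "\<sigma> 1 < \<sigma> 2"]
      by (simp add: t T4.m_assoc) (simp add: T4.m_assoc[symmetric] T4_prod_invol)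
  next
    case 2
    have "perm_transversal (\<sigma> \<circ> transpose 3 4) = B \<otimes>\<^bsub>T4\<^esub> (?s 1 (\<sigma> 1 < \<sigma> 2) \<otimes>\<^bsub>T4\<^esub> ?s 3 (\<not> \<sigma> 3 < \<sigma> 4))"
      unfolding perm_transversal_def transversal_def split B_def
      by (simp add: transpose_def not_less(2))
    then show ?thesis
      using 2 B gens flip[OF gens(2), of "\<sigma> 3 < \<sigma> 4"] by (simp add: t T4.m_assoc)
  qed
qed

text \<open>The cocycle identity, obtained by adding up the edge identities along \<open>u\<close>.
  It yields surjectivity: a pure \<open>u\<close> started at the identity returns to the base
  vertex, and the collected free group element maps to \<open>T4_prod u\<close>.\<close>

lemma gen_map_fold_rstep:
  assumes "u \<in> lists T4_gens" "x \<in> rstates"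
  shows "gen_map (snd (fold rstep u x)) \<otimes>\<^bsub>T4\<^esub> perm_transversal (fst (fold rstep u x)) =
    gen_map (snd x) \<otimes>\<^bsub>T4\<^esub> perm_transversal (fst x) \<otimes>\<^bsub>T4\<^esub> T4_prod u"
  using assms
proof (induction u arbitrary: x)
  case Nil
  then show ?case by (auto simp: rstates_def)
next
  case (Cons i u)
  obtain \<sigma> f where x: "x = (\<sigma>, f)" "\<sigma> permutes {1..4}" "f \<in> carrier F7"
    using Cons.prems by (auto simp: rstates_def)
  have "i \<in> T4_gens" using Cons.hyps by simp
  then have i: "i = 2 \<or> i \<in> {1, 3}" "i \<in> T4_gens" by (auto simp: T4_gens_def)
  have step: "gen_map (snd (rstep i x)) \<otimes>\<^bsub>T4\<^esub> perm_transversal (fst (rstep i x)) =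
      gen_map (snd x) \<otimes>\<^bsub>T4\<^esub> perm_transversal (fst x) \<otimes>\<^bsub>T4\<^esub> T4_prod [i]"
    using i(1)
  proof
    assume "i = 2"
    then show ?thesis
      using x i(2) edge_value_closed[of \<sigma>] perm_transversal_edge[OF x(2)] by (simp add: T4.m_assoc)
  next
    assume "i \<in> {1, 3}"
    then have "i \<noteq> 2" by auto
    then show ?thesis
      using x i(2) perm_transversal_13[OF x(2) \<open>i \<in> {1, 3}\<close>] by (simp add: T4.m_assoc)
  qed
  have u: "u \<in> lists T4_gens" using Cons.hyps by simp
  have "snd x \<in> carrier F7" using x by simp
  then have "gen_map (snd x) \<otimes>\<^bsub>T4\<^esub> perm_transversal (fst x) \<otimes>\<^bsub>T4\<^esub> T4_prod (i # u) =
      gen_map (snd (rstep i x)) \<otimes>\<^bsub>T4\<^esub> perm_transversal (fst (rstep i x)) \<otimes>\<^bsub>T4\<^esub> T4_prod u"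
    unfolding step T4_prod_Cons[OF i(2) u] using i(2) u by (simp add: T4.m_assoc)
  then show ?case
    using Cons.IH[OF rstep_closed[OF i(2) Cons.prems]] by simp
qed

lemma permutes_4_eqI:
  assumes "\<sigma> permutes {1..4::nat}" "\<tau> permutes {1..4::nat}"
    "\<sigma> 1 = \<tau> 1" "\<sigma> 2 = \<tau> 2" "\<sigma> 3 = \<tau> 3" "\<sigma> 4 = \<tau> 4"
  shows "\<sigma> = \<tau>"
proof
  fix x :: nat
  have "x \<in> {1, 2, 3, 4} \<or> x \<notin> {1..4}" by auto
  then show "\<sigma> x = \<tau> x"
    using assms by (auto simp: permutes_not_in)
qed

text \<open>The word runs through the tree, crosses edge \<open>k\<close> once in its positive
  direction and returns through the tree, so exactly one generator is collected.\<close>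

lemma fold_rstep_gen_word:
  assumes "k \<in> {1..7}" "f \<in> carrier F7"
  shows "fold rstep (gen_word k) (id, f) = (id, f \<otimes>\<^bsub>F7\<^esub> F7_gen k)"
proof (rule prod_eqI)
  have "fold rstep (gen_word k) (id, f) \<in> rstates"
    using assms by (intro fold_rstep_closed gen_word_lists) (auto simp: rstates_def permutes_id)
  then have "fst (fold rstep (gen_word k) (id, f)) permutes {1..4}"
    by (auto simp: rstates_def)
  then show "fst (fold rstep (gen_word k) (id, f)) = fst (id, f \<otimes>\<^bsub>F7\<^esub> F7_gen k)"
    using assms(1) unfolding fst_fold_rstep atLeastAtMost_1_7
    by (intro permutes_4_eqI) (auto simp: gen_word_simps transpose_def permutes_id)
  show "snd (fold rstep (gen_word k) (id, f)) = snd (id, f \<otimes>\<^bsub>F7\<^esub> F7_gen k)"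
    using assms(2) assms(1)[unfolded atLeastAtMost_1_7]
    by (elim insertE) (simp_all add: gen_word_simps transpose_def edge_value_def edge_label_def F7_gen_closed Let_def)
qed

section \<open>The pure twin group\<close>

lemma fold_rstep_inv_gen_word:
  assumes "k \<in> {1..7}" "f \<in> carrier F7"
  shows "fold rstep (rev (gen_word k)) (id, f) = (id, f \<otimes>\<^bsub>F7\<^esub> inv\<^bsub>F7\<^esub> F7_gen k)"
proof -
  have k: "F7_gen k \<in> carrier F7" using assms F7_gen_closed by simp
  have "fold rstep (gen_word k) (id, f \<otimes>\<^bsub>F7\<^esub> inv\<^bsub>F7\<^esub> F7_gen k) = (id, f)"
    using assms k by (simp add: fold_rstep_gen_word F7.m_assoc)
  moreover have "(id, f \<otimes>\<^bsub>F7\<^esub> inv\<^bsub>F7\<^esub> F7_gen k) \<in> rstates"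
    using assms(2) k by (simp add: rstates_def permutes_id)
  ultimately show ?thesis
    using fold_rstep_rev[OF gen_word_lists[OF assms(1)]] by metis
qed

text \<open>Acting by a word for \<open>gen_map g\<close> multiplies the second component by
  \<open>g\<close>, so \<open>g\<close> can be read off from its image. This is the source of
  injectivity.\<close>

lemma gen_map_word:
  assumes "g \<in> carrier F7"
  obtains u where "u \<in> lists T4_gens" "gen_map g = T4_prod u"
    "\<And>f. f \<in> carrier F7 \<Longrightarrow> fold rstep u (id, f) = (id, f \<otimes>\<^bsub>F7\<^esub> g)"
proof -
  obtain w where w: "w \<in> gwords {1..7}" "g = word_class {1..7} {} w"
    using assms by (auto simp: free_group_def presented_group_def)
  have "\<exists>u\<in>lists T4_gens. gen_map (word_class {1..7} {} w) = T4_prod u \<and>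
      (\<forall>f\<in>carrier F7. fold rstep u (id, f) = (id, f \<otimes>\<^bsub>F7\<^esub> word_class {1..7} {} w))"
    using w(1)
  proof (induction w)
    case Nil
    have one: "word_class {1..7} {} [] = \<one>\<^bsub>F7\<^esub>"
      by (simp add: free_group_def presented_group_def)
    show ?case by (intro bexI[of _ "[]"]) (simp_all add: one)
  next
    case (Cons p w)
    then have "w \<in> gwords {1..7}" by simp
    then obtain u where u: "u \<in> lists T4_gens" "gen_map (word_class {1..7} {} w) = T4_prod u"
      "\<And>f. f \<in> carrier F7 \<Longrightarrow> fold rstep u (id, f) = (id, f \<otimes>\<^bsub>F7\<^esub> word_class {1..7} {} w)"
      using Cons.IH by blast
    obtain k b where p: "p = (k, b)" by fastforce
    have k: "k \<in> {1..7}" using Cons.prems p by simp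
    let ?v = "if b then gen_word k else rev (gen_word k)"
    define x where "x = (if b then F7_gen k else inv\<^bsub>F7\<^esub> F7_gen k)"
    have x: "x \<in> carrier F7" using k F7_gen_closed by (simp add: x_def)
    have wc: "word_class {1..7} {} w \<in> carrier F7"
      using Cons.prems by (auto simp: free_group_def presented_group_def)
    \<comment> \<open>The class of the formal inverse letter is identified with the group inverse of
      the generator.\<close>
    have "word_class {1..7} {} [(k, False)] \<otimes>\<^bsub>F7\<^esub> F7_gen k = \<one>\<^bsub>F7\<^esub>"
      using k word_eq.cancel[of "[]" "{1..7}" "[]" k "{}" False]
      by (simp add: F7_gen_def free_group_def presented_group_mult)
        (simp add: presented_group_def word_class_eq_iff)
    then have "inv\<^bsub>F7\<^esub> F7_gen k = word_class {1..7} {} [(k, False)]"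
      using k F7_gen_closed[of k]
      by (intro F7.inv_equality) (auto simp: free_group_def presented_group_def)
    then have "word_class {1..7} {} [p] = x"
      using p by (simp add: x_def F7_gen_def)
    then have mult: "word_class {1..7} {} (p # w) = x \<otimes>\<^bsub>F7\<^esub> word_class {1..7} {} w"
      using presented_group_mult[of "[p]" "{1..7}" w "{}"] Cons.prems by (simp add: free_group_def)
    have "gen_map x = T4_prod ?v"
      using k F7_gen_closed gen_word_lists by (simp add: x_def gen_map_gen T4_prod_inv)
    then have "gen_map (word_class {1..7} {} (p # w)) = T4_prod (?v @ u)"
      using u gen_word_lists[OF k] x wc by (simp add: mult T4_prod_append)
    moreover have "fold rstep (?v @ u) (id, f) = (id, f \<otimes>\<^bsub>F7\<^esub> word_class {1..7} {} (p # w))"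
      if "f \<in> carrier F7" for f
    proof -
      have "fold rstep ?v (id, f) = (id, f \<otimes>\<^bsub>F7\<^esub> x)"
        using that k by (simp add: x_def fold_rstep_gen_word fold_rstep_inv_gen_word)
      then show ?thesis using that x wc u(3)[of "f \<otimes>\<^bsub>F7\<^esub> x"] by (simp add: mult F7.m_assoc)
    qed
    moreover have "?v @ u \<in> lists T4_gens" using gen_word_lists[OF k] u(1) by simp
    ultimately show ?case by blast
  qed
  then show ?thesis using w(2) that by blast
qed

lemma mem_PT4: "g \<in> carrier PT4 \<longleftrightarrow> g \<in> carrier T4 \<and> T4_to_S4 g = id"
  by (auto simp: PT4_def kernel_def sym_group_one)

lemma group_hom_T4_to_S4: "group_hom T4 (sym_group 4) T4_to_S4"
  by (intro group_hom.intro group_hom_axioms.intro T4.group_axioms sym_group_is_group T4_to_S4_hom)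

lemma PT4_normal: "carrier PT4 \<lhd> T4"
  using group_hom.normal_kernel[OF group_hom_T4_to_S4] by (simp add: PT4_def)

lemma PT4_group: "group PT4"
  using T4.subgroup_imp_group[OF group_hom.subgroup_kernel[OF group_hom_T4_to_S4]]
  by (simp add: PT4_def)

lemma T4_to_S4_fold_rstep: "u \<in> lists T4_gens \<Longrightarrow> T4_to_S4 (T4_prod u) = fst (fold rstep u (id, f))"
  by (simp only: T4_to_S4_prod fst_fold_rstep fst_conv)

lemma gen_map_iso: "gen_map \<in> iso F7 PT4"
proof (rule isoI)
  have mem: "gen_map g \<in> carrier PT4" if g: "g \<in> carrier F7" for g
  proof -
    obtain u where "u \<in> lists T4_gens" "gen_map g = T4_prod u"
      "fold rstep u (id, \<one>\<^bsub>F7\<^esub>) = (id, \<one>\<^bsub>F7\<^esub> \<otimes>\<^bsub>F7\<^esub> g)"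
      using gen_map_word[OF g] F7.one_closed by metis
    then show ?thesis
      using T4_to_S4_fold_rstep[of u "\<one>\<^bsub>F7\<^esub>"] by (simp add: mem_PT4)
  qed
  then show "gen_map \<in> hom F7 PT4"
    using gen_map_hom by (auto simp: hom_def PT4_def)
  have "inj_on gen_map (carrier F7)"
  proof (rule inj_onI)
    fix g h assume g: "g \<in> carrier F7" and h: "h \<in> carrier F7" and eq: "gen_map g = gen_map h"
    obtain u where u: "u \<in> lists T4_gens" "gen_map g = T4_prod u"
      "fold rstep u (id, \<one>\<^bsub>F7\<^esub>) = (id, \<one>\<^bsub>F7\<^esub> \<otimes>\<^bsub>F7\<^esub> g)"
      using gen_map_word[OF g] F7.one_closed by metis
    obtain v where v: "v \<in> lists T4_gens" "gen_map h = T4_prod v"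
      "fold rstep v (id, \<one>\<^bsub>F7\<^esub>) = (id, \<one>\<^bsub>F7\<^esub> \<otimes>\<^bsub>F7\<^esub> h)"
      using gen_map_word[OF h] F7.one_closed by metis
    have "fold rstep u (id, \<one>\<^bsub>F7\<^esub>) = fold rstep v (id, \<one>\<^bsub>F7\<^esub>)"
      using u v eq by (intro fold_rstep_cong) (auto simp: rstates_def permutes_id)
    then show "g = h" using u v g h by simp
  qed
  moreover have "g \<in> gen_map ` carrier F7" if g: "g \<in> carrier PT4" for g
  proof -
    obtain u where u: "u \<in> lists T4_gens" "g = T4_prod u"
      using g T4_prod_cases[of g] by (auto simp: mem_PT4)
    have x: "(id, \<one>\<^bsub>F7\<^esub>) \<in> rstates" by (simp add: rstates_def permutes_id)
    obtain f where f: "fold rstep u (id, \<one>\<^bsub>F7\<^esub>) = (id, f)"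
      using T4_to_S4_fold_rstep[OF u(1), of "\<one>\<^bsub>F7\<^esub>"] g u(2) by (metis mem_PT4 prod.collapse)
    have "f \<in> carrier F7"
      using fold_rstep_closed[OF u(1) x] f by (simp add: rstates_def)
    \<comment> \<open>The base vertex has the empty transversal word, so the cocycle identity
      reduces to \<open>gen_map f = g\<close>.\<close>
    moreover have "perm_transversal id = \<one>\<^bsub>T4\<^esub>"
      by (simp add: perm_transversal_def transversal_def base_word_def)
    ultimately have "gen_map f = g"
      using gen_map_fold_rstep[OF u(1) x] f u by simp
    then show ?thesis using \<open>f \<in> carrier F7\<close> by blast
  qed
  ultimately show "bij_betw gen_map (carrier F7) (carrier PT4)"
    using mem by (auto simp: bij_betw_def)
qed

section \<open>Triviality of the centraliser of the pure twin group\<close>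

lemma T4_centralizer_PT4:
  assumes g: "g \<in> carrier T4" and comm: "\<And>h. h \<in> carrier PT4 \<Longrightarrow> g \<otimes>\<^bsub>T4\<^esub> h = h \<otimes>\<^bsub>T4\<^esub> g"
  shows "g = \<one>\<^bsub>T4\<^esub>"
proof -
  have PT4: "T4_prod u \<in> carrier PT4"
    if u: "u \<in> lists T4_gens" and id: "\<And>j. j \<in> {1, 2, 3, 4} \<Longrightarrow> T4_to_S4 (T4_prod u) j = j" for u
  proof -
    have "T4_to_S4 (T4_prod u) permutes {1..4}"
      using hom_in_carrier[OF T4_to_S4_hom, of "T4_prod u"] u by (simp add: sym_group_carrier)
    then have "T4_to_S4 (T4_prod u) = id"
      using id by (intro permutes_4_eqI) (auto simp: permutes_id)
    then show ?thesis using u by (simp add: mem_PT4)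
  qed
  \<comment> \<open>\<open>?h\<close> is (s2 s3)^3 (s1 s2)^3, pure because both products map to
    3-cycles, and \<open>?h'\<close> is its conjugate by s2. At the inner junction \<open>3\<close>
    precedes \<open>1\<close>, as normal forms require.\<close>
  let ?h = "[2,3,2,3,2,3,1,2,1,2,1,2]" and ?h' = "[3,2,3,2,3,1,2,1,2,1]"
  have "?h \<in> lists T4_gens" "?h' \<in> lists T4_gens" by (simp_all add: T4_gens_def)
  then have "T4_prod ?h \<in> carrier PT4" "T4_prod ?h' \<in> carrier PT4"
    by (auto intro!: PT4 simp: T4_to_S4_prod transpose_def)
  then show ?thesis
    by (intro T4_commuting_trivial[of g ?h ?h'] g comm) (simp_all add: normal_forms_def T4_gens_def)
qed

theorem proposition4p9:
  shows "carrier PT4 \<lhd> T4 \<and>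
    PT4 \<cong> free_group {1..7::nat} \<and>
    AutoGroup PT4 \<cong> AutoGroup (free_group {1..7::nat}) \<and>
    phi4 \<in> hom T4 (AutoGroup PT4) \<and>
    inj_on phi4 (carrier T4)"
proof (intro conjI)
  show "carrier PT4 \<lhd> T4" by (rule PT4_normal)
  have "F7 \<cong> PT4" using gen_map_iso by (rule is_isoI)
  then show iso: "PT4 \<cong> F7" by (rule F7.iso_sym)
  show "AutoGroup PT4 \<cong> AutoGroup F7"
    using PT4_group F7.group_axioms iso by (rule AutoGroup_cong)
  show hom: "phi4 \<in> hom T4 (AutoGroup PT4)"
    using T4.conj_action_hom[OF PT4_normal] by (simp add: phi4_def[abs_def] PT4_def)
  show "inj_on phi4 (carrier T4)"
  proof (subst inj_on_one_iff'[OF hom T4.group_axioms group.AutoGroup[OF PT4_group]], intro allI impI)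
    fix g assume g: "g \<in> carrier T4" and one: "phi4 g = \<one>\<^bsub>AutoGroup PT4\<^esub>"
    have "g \<otimes>\<^bsub>T4\<^esub> h = h \<otimes>\<^bsub>T4\<^esub> g" if h: "h \<in> carrier PT4" for h
    proof -
      have "g \<otimes>\<^bsub>T4\<^esub> h \<otimes>\<^bsub>T4\<^esub> inv\<^bsub>T4\<^esub> g = h"
        using fun_cong[OF one, of h] h by (simp add: phi4_def AutoGroup_def BijGroup_def)
      then show ?thesis using g h by (metis T4.inv_solve_right' T4.m_closed mem_PT4)
    qed
    then show "g = \<one>\<^bsub>T4\<^esub>" by (rule T4_centralizer_PT4[OF g])
  qed
qed

end
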